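(* Let $t\in\mathbb Q$, $t\ne0,\pm1,\pm2$, be primitive and twin primitive, and not cyclotomic. Then the torsion subgroup of the Laxton group $\mathcal G(t)$ contains only the $4$ elements (represented by) $I$, $C=[2\ t]$, $W=[-1\ 1]$ and $V=[1\ 1]$, and it is isomorphic to $\mathbb Z_2\times\mathbb Z_2$.
   Context: For $t\in\mathbb Q$ let $D_t=\begin{pmatrix}0&-1\\1&t\end{pmatrix}$ and let $\mathcal R(t)$ be the commutative ring of all $2\times2$ rational matrices commuting with $D_t$; its elements are the matrices $[x_0\ x_1]:=\begin{pmatrix}x_1-tx_0&-x_0\\ x_0&x_1\end{pmatrix}$, $x_0,x_1\in\mathbb Q$ (so $I=[0\ 1]$). The sequence group $\mathcal L(t)$ is the commutative group of elements of $\mathcal R(t)$ with nonzero determinant modulo multiplication by nonzero rational scalars. The Laxton group is $\mathcal G(t)=\mathcal L(t)/\langle D_t\rangle$, the quotient by the cyclic subgroup generated by the class of $D_t$. Let $C_r(t)=\operatorname{tr}D_t^r$ (Chebyshev polynomials: $C_0=2$, $C_1(t)=t$, $C_{n+1}=tC_n-C_{n-1}$). A rational $t$ is $r$-primitive if there is no rational $u$ with $t=C_r(u)$; it is primitive if it is $r$-primitive for all natural $r\ge2$; it is twin primitive if both $t$ and $-t$ are $2$-primitive. $t$ is circular if $t^2-4=-a^2$ for some rational $a$, cubic if $t^2-4=-3f^2$ for some rational $f$, and cyclotomic if it is circular or cubic. *)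

theory Defs
  imports "HOL-Analysis.Analysis" "HOL-Algebra.Ring" "HOL-Algebra.Elementary_Groups"
begin

type_synonym rat_mat2 = "rat^2^2"

definition D_mat :: "rat \<Rightarrow> rat_mat2" where
  "D_mat t = vector [vector [0, -1], vector [1, t]]"

text \<open>\<open>elt t x\<^sub>0 x\<^sub>1\<close> is the matrix written \<open>[x\<^sub>0 x\<^sub>1]\<close>.\<close>

definition elt :: "rat \<Rightarrow> rat \<Rightarrow> rat \<Rightarrow> rat_mat2" where
  "elt t x0 x1 = vector [vector [x1 - t * x0, - x0], vector [x0, x1]]"

definition comm_ring_R :: "rat \<Rightarrow> rat_mat2 ring" where
  "comm_ring_R t =
     \<lparr>carrier = {X. X ** D_mat t = D_mat t ** X}, monoid.mult = (\<lambda>X Y. X ** Y), one = mat 1, zero = 0, add = (+)\<rparr>"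

definition nonsingular_R :: "rat \<Rightarrow> rat_mat2 monoid" where
  "nonsingular_R t =
     \<lparr>carrier = {X \<in> carrier (comm_ring_R t). det X \<noteq> 0}, monoid.mult = (\<lambda>X Y. X ** Y), one = mat 1\<rparr>"

definition scalar_mats :: "rat_mat2 set" where
  "scalar_mats = {mat c | c. c \<noteq> 0}"

definition seq_group :: "rat \<Rightarrow> rat_mat2 set monoid" where
  "seq_group t = nonsingular_R t Mod scalar_mats"

definition seq_class :: "rat \<Rightarrow> rat_mat2 \<Rightarrow> rat_mat2 set" where
  "seq_class t X = scalar_mats #>\<^bsub>nonsingular_R t\<^esub> X"

definition D_subgroup :: "rat \<Rightarrow> rat_mat2 set set" where
  "D_subgroup t = generate (seq_group t) {seq_class t (D_mat t)}"

definition laxton_group :: "rat \<Rightarrow> rat_mat2 set set monoid" where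
  "laxton_group t = seq_group t Mod D_subgroup t"

definition laxton_class :: "rat \<Rightarrow> rat_mat2 \<Rightarrow> rat_mat2 set set" where
  "laxton_class t X = D_subgroup t #>\<^bsub>seq_group t\<^esub> seq_class t X"

definition torsion_set :: "('a, 'b) monoid_scheme \<Rightarrow> 'a set" where
  "torsion_set G = {x \<in> carrier G. \<exists>n::nat. n > 0 \<and> x [^]\<^bsub>G\<^esub> n = \<one>\<^bsub>G\<^esub>}"

definition torsion_subgroup :: "('a, 'b) monoid_scheme \<Rightarrow> ('a, 'b) monoid_scheme" where
  "torsion_subgroup G = G\<lparr>carrier := torsion_set G\<rparr>"

definition C_poly :: "nat \<Rightarrow> rat \<Rightarrow> rat" where
  "C_poly r t = trace (D_mat t [^]\<^bsub>comm_ring_R t\<^esub> r)"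

definition r_primitive :: "nat \<Rightarrow> rat \<Rightarrow> bool" where
  "r_primitive r t \<longleftrightarrow> \<not> (\<exists>u. t = C_poly r u)"

definition primitive :: "rat \<Rightarrow> bool" where
  "primitive t \<longleftrightarrow> (\<forall>r\<ge>2. r_primitive r t)"

definition twin_primitive :: "rat \<Rightarrow> bool" where
  "twin_primitive t \<longleftrightarrow> r_primitive 2 t \<and> r_primitive 2 (- t)"

definition circular :: "rat \<Rightarrow> bool" where
  "circular t \<longleftrightarrow> (\<exists>a::rat. t^2 - 4 = - (a^2))"

definition cubic :: "rat \<Rightarrow> bool" where
  "cubic t \<longleftrightarrow> (\<exists>f::rat. t^2 - 4 = - 3 * f^2)"

definition cyclotomic :: "rat \<Rightarrow> bool" where
  "cyclotomic t \<longleftrightarrow> circular t \<or> cubic t"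

lemma mat2_eq_iff:
  fixes A B :: rat_mat2
  shows "A = B \<longleftrightarrow> A$1$1 = B$1$1 \<and> A$1$2 = B$1$2 \<and> A$2$1 = B$2$1 \<and> A$2$2 = B$2$2"
  by (auto simp: vec_eq_iff forall_2)

lemma mat2_mult_nth:
  fixes A B :: rat_mat2
  shows "(A ** B)$i$j = A$i$1 * B$1$j + A$i$2 * B$2$j"
  by (simp add: matrix_matrix_mult_def sum_2)

lemma mat2_add_mult:
  fixes A B C :: rat_mat2
  shows "(A + B) ** C = A ** C + B ** C"
  by (simp add: mat2_eq_iff mat2_mult_nth distrib_right)

lemma mat2_nth:
  "(mat c :: rat_mat2)$1$1 = c" "(mat c :: rat_mat2)$1$2 = 0"
  "(mat c :: rat_mat2)$2$1 = 0" "(mat c :: rat_mat2)$2$2 = c"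
  by (simp_all add: mat_def)

lemma elt_nth:
  "elt t x0 x1$1$1 = x1 - t * x0" "elt t x0 x1$1$2 = - x0"
  "elt t x0 x1$2$1 = x0" "elt t x0 x1$2$2 = x1"
  by (simp_all add: elt_def vector_2)

lemma D_mat_eq_elt: "D_mat t = elt t 1 t"
  and one_eq_elt: "mat 1 = elt t 0 1"
  by (auto simp: D_mat_def elt_def mat2_eq_iff mat2_nth vector_2)

lemma carrier_comm_ring_R: "carrier (comm_ring_R t) = {elt t x0 x1 | x0 x1. True}"
proof (intro equalityI subsetI)
  fix X assume "X \<in> carrier (comm_ring_R t)"
  then have "X ** D_mat t = D_mat t ** X"
    by (simp add: comm_ring_R_def)
  then have "X = elt t (X$2$1) (X$2$2)"
    unfolding D_mat_eq_elt mat2_eq_iff mat2_mult_nth elt_nth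
    by (auto simp: algebra_simps)
  then show "X \<in> {elt t x0 x1 | x0 x1. True}" by blast
next
  fix X assume "X \<in> {elt t x0 x1 | x0 x1. True}"
  then obtain x0 x1 where X: "X = elt t x0 x1" by blast
  show "X \<in> carrier (comm_ring_R t)"
    unfolding X comm_ring_R_def D_mat_eq_elt
    by (simp add: mat2_eq_iff mat2_mult_nth elt_nth algebra_simps)
qed

lemma elt_mult: "elt t a b ** elt t c d = elt t (a * d + b * c - t * a * c) (b * d - a * c)"
  by (simp add: mat2_eq_iff mat2_mult_nth elt_nth algebra_simps)

lemma elt_add: "elt t a b + elt t c d = elt t (a + c) (b + d)"
  by (simp add: mat2_eq_iff elt_nth algebra_simps)

lemma cring_comm_ring_R: "cring (comm_ring_R t)"
proof (rule cringI)
  show "abelian_group (comm_ring_R t)"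
  proof (rule abelian_groupI)
    fix X assume "X \<in> carrier (comm_ring_R t)"
    then obtain a b where X: "X = elt t a b"
      by (auto simp: carrier_comm_ring_R)
    show "\<exists>Y\<in>carrier (comm_ring_R t). Y \<oplus>\<^bsub>comm_ring_R t\<^esub> X = \<zero>\<^bsub>comm_ring_R t\<^esub>"
      by (rule bexI[of _ "elt t (-a) (-b)"])
        (auto simp: carrier_comm_ring_R X, simp add: comm_ring_R_def mat2_eq_iff elt_nth)
  qed (auto simp: comm_ring_R_def mat2_add_mult matrix_add_ldistrib add_ac)
  show "Group.comm_monoid (comm_ring_R t)"
  proof (rule comm_monoidI)
    fix X Y assume "X \<in> carrier (comm_ring_R t)" "Y \<in> carrier (comm_ring_R t)"
    then obtain a b c d where XY: "X = elt t a b" "Y = elt t c d"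
      by (auto simp: carrier_comm_ring_R)
    show "X \<otimes>\<^bsub>comm_ring_R t\<^esub> Y \<in> carrier (comm_ring_R t)"
      unfolding carrier_comm_ring_R XY by (auto simp: comm_ring_R_def elt_mult)
    show "X \<otimes>\<^bsub>comm_ring_R t\<^esub> Y = Y \<otimes>\<^bsub>comm_ring_R t\<^esub> X"
      unfolding XY by (simp add: comm_ring_R_def elt_mult algebra_simps)
  qed (auto simp: comm_ring_R_def matrix_mul_assoc)
next
  fix X Y Z
  assume "X \<in> carrier (comm_ring_R t)" "Y \<in> carrier (comm_ring_R t)" "Z \<in> carrier (comm_ring_R t)"
  show "(X \<oplus>\<^bsub>comm_ring_R t\<^esub> Y) \<otimes>\<^bsub>comm_ring_R t\<^esub> Z =
      X \<otimes>\<^bsub>comm_ring_R t\<^esub> Z \<oplus>\<^bsub>comm_ring_R t\<^esub> Y \<otimes>\<^bsub>comm_ring_R t\<^esub> Z"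
    by (simp add: comm_ring_R_def mat2_add_mult)
qed

lemma det_elt: "det (elt t a b) = b^2 - t * a * b + a^2"
  by (simp add: det_2 elt_nth power2_eq_square algebra_simps)

lemma comm_group_nonsingular_R: "comm_group (nonsingular_R t)"
proof (rule comm_groupI)
  interpret R: cring "comm_ring_R t" by (rule cring_comm_ring_R)
  note sel = nonsingular_R_def comm_ring_R_def
  fix X Y assume X: "X \<in> carrier (nonsingular_R t)" and Y: "Y \<in> carrier (nonsingular_R t)"
  show "X \<otimes>\<^bsub>nonsingular_R t\<^esub> Y \<in> carrier (nonsingular_R t)"
    using R.m_closed[of X Y] X Y by (auto simp: sel det_mul)
  show "X \<otimes>\<^bsub>nonsingular_R t\<^esub> Y = Y \<otimes>\<^bsub>nonsingular_R t\<^esub> X"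
    using R.m_comm[of X Y] X Y by (auto simp: sel)
next
  fix X assume "X \<in> carrier (nonsingular_R t)"
  then obtain a b where X: "X = elt t a b" and d: "det (elt t a b) \<noteq> 0"
    by (auto simp: nonsingular_R_def carrier_comm_ring_R)
  define e where "e = det (elt t a b)"
  define Y where "Y = elt t (- a / e) ((b - t * a) / e)"
  have e: "e \<noteq> 0" "e = b^2 - t * a * b + a^2"
    using d by (auto simp: e_def det_elt)
  have YX: "Y ** X = mat 1"
  proof -
    have 1: "- a / e * b + (b - t * a) / e * a - t * (- a / e) * a = 0"
      using e(1) by (simp add: field_simps)
    have "(b - t * a) / e * b - - a / e * a = (b^2 - t * a * b + a^2) / e"
      using e(1) by (simp add: field_simps power2_eq_square)
    then have 2: "(b - t * a) / e * b - - a / e * a = 1"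
      using e by simp
    show ?thesis
      unfolding Y_def X elt_mult 1 2 by (rule one_eq_elt[symmetric])
  qed
  then have "det Y * det X = 1"
    by (metis det_I det_mul)
  then have "det Y \<noteq> 0" by auto
  then have "Y \<in> carrier (nonsingular_R t)"
    unfolding nonsingular_R_def carrier_comm_ring_R by (auto simp: Y_def)
  then show "\<exists>Y\<in>carrier (nonsingular_R t). Y \<otimes>\<^bsub>nonsingular_R t\<^esub> X = \<one>\<^bsub>nonsingular_R t\<^esub>"
    using YX by (auto simp: nonsingular_R_def)
qed (auto simp: nonsingular_R_def comm_ring_R_def matrix_mul_assoc)

lemma subgroup_scalar_mats: "subgroup scalar_mats (nonsingular_R t)"
proof -
  interpret N: comm_group "nonsingular_R t" by (rule comm_group_nonsingular_R)
  have mem: "mat c \<in> carrier (nonsingular_R t)" if "c \<noteq> 0" for c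
    using that
    by (simp add: nonsingular_R_def comm_ring_R_def mat2_eq_iff mat2_mult_nth mat2_nth det_2)
  have mult: "mat c \<otimes>\<^bsub>nonsingular_R t\<^esub> mat d = mat (c * d)" for c d
    by (simp add: nonsingular_R_def mat2_eq_iff mat2_mult_nth mat2_nth)
  have one: "\<one>\<^bsub>nonsingular_R t\<^esub> = mat 1"
    by (simp add: nonsingular_R_def)
  show ?thesis
  proof (rule N.subgroupI)
    fix X assume "X \<in> scalar_mats"
    then obtain c where c: "X = mat c" "c \<noteq> 0" by (auto simp: scalar_mats_def)
    have "inv\<^bsub>nonsingular_R t\<^esub> X = mat (inverse c)"
      by (rule N.inv_equality) (use c mem in \<open>auto simp: mult one\<close>)
    then show "inv\<^bsub>nonsingular_R t\<^esub> X \<in> scalar_mats"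
      using c by (auto simp: scalar_mats_def)
  next
    fix X Y assume "X \<in> scalar_mats" "Y \<in> scalar_mats"
    then obtain c d where "X = mat c" "c \<noteq> 0" "Y = mat d" "d \<noteq> 0"
      by (auto simp: scalar_mats_def)
    then have "X \<otimes>\<^bsub>nonsingular_R t\<^esub> Y = mat (c * d)" "c * d \<noteq> 0"
      by (auto simp: mult)
    then show "X \<otimes>\<^bsub>nonsingular_R t\<^esub> Y \<in> scalar_mats"
      unfolding scalar_mats_def by blast
  qed (use mem in \<open>auto simp: scalar_mats_def intro: exI[of _ 1]\<close>)
qed

lemma comm_group_seq_group: "comm_group (seq_group t)"
  unfolding seq_group_def
  by (rule comm_group.abelian_FactGroup[OF comm_group_nonsingular_R subgroup_scalar_mats])

lemma D_mat_in_nonsingular_R: "D_mat t \<in> carrier (nonsingular_R t)"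
  by (simp add: nonsingular_R_def comm_ring_R_def D_mat_def det_2 vector_2)

lemma subgroup_D_subgroup: "subgroup (D_subgroup t) (seq_group t)"
proof -
  interpret L: comm_group "seq_group t" by (rule comm_group_seq_group)
  have "seq_class t (D_mat t) \<in> carrier (seq_group t)"
    using D_mat_in_nonsingular_R[of t]
    by (auto simp: seq_group_def seq_class_def carrier_FactGroup)
  then show ?thesis
    unfolding D_subgroup_def by (intro L.generate_is_subgroup) simp
qed

lemma comm_group_laxton_group: "comm_group (laxton_group t)"
  unfolding laxton_group_def
  by (rule comm_group.abelian_FactGroup[OF comm_group_seq_group subgroup_D_subgroup])

lemma subgroup_torsion_set:
  assumes "comm_group G"
  shows "subgroup (torsion_set G) G"
proof -
  interpret comm_group G by fact
  show ?thesis
  proof (rule subgroupI)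
    show "torsion_set G \<subseteq> carrier G" by (auto simp: torsion_set_def)
    have "\<one>\<^bsub>G\<^esub> \<in> torsion_set G"
      by (auto simp: torsion_set_def intro: exI[of _ 1])
    then show "torsion_set G \<noteq> {}" by blast
  next
    fix x assume "x \<in> torsion_set G"
    then show "inv\<^bsub>G\<^esub> x \<in> torsion_set G"
      by (auto simp: torsion_set_def nat_pow_inv)
  next
    fix x y assume "x \<in> torsion_set G" "y \<in> torsion_set G"
    then obtain m n :: nat where mn: "x \<in> carrier G" "y \<in> carrier G" "m > 0" "n > 0"
      "x [^]\<^bsub>G\<^esub> m = \<one>\<^bsub>G\<^esub>" "y [^]\<^bsub>G\<^esub> n = \<one>\<^bsub>G\<^esub>"
      by (auto simp: torsion_set_def)
    have "x [^]\<^bsub>G\<^esub> (m * n) = \<one>\<^bsub>G\<^esub>" "y [^]\<^bsub>G\<^esub> (m * n) = \<one>\<^bsub>G\<^esub>"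
      using mn by (metis nat_pow_pow nat_pow_one, metis nat_pow_pow nat_pow_one mult.commute)
    then have "(x \<otimes>\<^bsub>G\<^esub> y) [^]\<^bsub>G\<^esub> (m * n) = \<one>\<^bsub>G\<^esub>"
      using mn by (simp add: pow_mult_distrib m_comm)
    then show "x \<otimes>\<^bsub>G\<^esub> y \<in> torsion_set G"
      using mn by (auto simp: torsion_set_def intro!: exI[of _ "m * n"])
  qed
qed

lemma C_poly_0: "C_poly 0 t = 2"
  by (simp add: C_poly_def trace_def sum_2 comm_ring_R_def mat_def)

lemma C_poly_1: "C_poly 1 t = t"
  by (simp add: C_poly_def trace_def sum_2 comm_ring_R_def D_mat_def vector_2)

lemma C_poly_rec: "C_poly (Suc (Suc n)) t = t * C_poly (Suc n) t - C_poly n t"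
  by (simp add: C_poly_def trace_def sum_2 comm_ring_R_def mat2_mult_nth D_mat_def vector_2
      algebra_simps)

end

theory Submission
  imports Defs
begin

text \<open>
  The ring \<open>\<R>(t)\<close> is \<open>\<rat>[D]\<close> with \<open>D\<^sup>2 = tD - 1\<close>, and it has a conjugation exchanging \<open>D\<close> and \<open>D\<^sup>-\<^sup>1\<close>,
  with \<open>X X' = det X\<close> for the conjugate \<open>X'\<close> of \<open>X\<close>. The map \<open>X \<mapsto> X / X' = X\<^sup>2 / det X\<close> sends
  invertible elements to elements of determinant one, its kernel consists of the nonzero scalars, and
  it sends \<open>D\<close> to \<open>D\<^sup>2\<close>. Thus the Laxton group embeds into the group of norm-one elements modulo
  \<open>\<langle>D\<^sup>2\<rangle>\<close>, and all questions about classes become questions about powers of \<open>D\<close>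
  (\<open>laxton_class_eq_iff\<close>).

  A torsion class is therefore given by a norm-one element \<open>Y\<close> with \<open>Y\<^sup>n = D\<^sup>M\<close> for some \<open>n > 0\<close>. Two
  facts force \<open>Y = \<plusminus>D\<^sup>k\<close>. First, the only norm-one elements of finite order are \<open>\<plusminus>1\<close>
  (\<open>norm_one_torsion\<close>): the trace of such an element is a rational number at which a monic integer
  polynomial \<open>C\<^sub>n\<close> takes the value 2, so it is an integer of absolute value at most 2, and the traces \<open>0\<close>
  and \<open>\<plusminus>1\<close> would make \<open>t\<close> circular or cubic. Secondly, modulo \<open>\<plusminus>1\<close> the elements \<open>Y\<close> and \<open>D\<close> then
  generate an infinite cyclic group (\<open>root_of_power_in_powers\<close>), and \<open>D\<close> itself is a generator of it:
  if \<open>D = \<plusminus>U\<^sup>r\<close> with \<open>r \<ge> 2\<close>, then \<open>D\<close> is a proper power or minus a square, and taking traces writes \<open>t\<close> as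
  \<open>C\<^sub>r(u)\<close> or \<open>-t\<close> as \<open>C\<^sub>2(u)\<close>, which primitivity and twin primitivity exclude.

  Modulo \<open>D\<^sup>2\<close> only the sign and the parity of \<open>k\<close> matter, which gives at most four classes. The ratios of
  \<open>I\<close>, \<open>C\<close>, \<open>W\<close>, \<open>V\<close> are \<open>1\<close>, \<open>-1\<close>, \<open>D\<^sup>-\<^sup>1\<close>, \<open>-D\<^sup>-\<^sup>1\<close>, so all four occur; they are distinct because \<open>D\<close>
  has infinite order modulo \<open>\<plusminus>1\<close>, and each has square \<open>1\<close>.
\<close>

section \<open>Roots of powers in a commutative group\<close>

text \<open>Modulo \<open>{1, e}\<close> the subgroup \<open>H\<close> is torsion-free, so \<open>y\<close> and \<open>d\<close> generate a cyclic group there; a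
  Bezout combination \<open>u\<close> of the two is a generator, with \<open>d = u\<^sup>r\<close> up to a factor in \<open>{1, e}\<close>. The factor \<open>e\<close>
  can be absorbed into \<open>u\<close> for odd \<open>r\<close>, which is why only squares need the second exclusion. Hence
  \<open>r = 1\<close>.\<close>

lemma (in comm_group) root_of_power_in_powers:
  fixes n :: nat and M :: int
  assumes H: "subgroup H G" and e: "e \<in> H" "e \<otimes> e = \<one>"
    and torsion: "\<And>z n. z \<in> H \<Longrightarrow> n > (0::nat) \<Longrightarrow> z [^] n = \<one> \<Longrightarrow> z = \<one> \<or> z = e"
    and d: "d \<in> H"
    and not_power: "\<And>u r. u \<in> H \<Longrightarrow> r \<ge> (2::nat) \<Longrightarrow> d \<noteq> u [^] r"
    and not_square: "\<And>u. u \<in> H \<Longrightarrow> d \<noteq> e \<otimes> (u \<otimes> u)"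
    and y: "y \<in> H" "y [^] n = d [^] M" "n > 0"
  shows "\<exists>k::int. y = d [^] k \<or> y = e \<otimes> d [^] k"
proof -
  note HG [simp] = subgroup.mem_carrier[OF H]
  note cl [simp] = subgroup.m_closed[OF H] subgroup_int_pow_closed[OF H] e(1) d y(1)
  have npow_H [simp]: "u [^] (k::nat) \<in> H" if "u \<in> H" for u k
    using subgroup_int_pow_closed[OF H that, of "int k"] by (simp add: int_pow_int)
  define g where "g = gcd (int n) M"
  have g: "g > 0" using y(3) by (simp add: g_def)
  obtain n' m' where nm: "int n = g * n'" "M = g * m'"
    unfolding g_def by (meson gcd_dvd1 gcd_dvd2 dvdE)
  have n': "n' > 0" using nm(1) g y(3) by (metis of_nat_0_less_iff zero_less_mult_pos)
  obtain a b where ab: "a * n' + b * m' = 1"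
  proof -
    obtain a b where "a * int n + b * M = g"
      using bezout_int[of "int n" M] by (auto simp: g_def)
    then have "g * (a * n' + b * m') = g * 1" by (simp add: nm algebra_simps)
    then show ?thesis using that g by (metis mult_cancel_left less_irrefl)
  qed
  \<comment> \<open>Divide the exponents by their greatest common divisor, at the price of a torsion factor \<open>s\<close>.\<close>
  define s where "s = y [^] n' \<otimes> d [^] (- m')"
  have sH: "s \<in> H" by (simp add: s_def)
  have "s [^] g = y [^] int n \<otimes> d [^] (- M)"
    by (simp add: s_def int_pow_distrib int_pow_pow nm mult.commute)
  also have "\<dots> = \<one>"
    using y(2) by (simp add: int_pow_int int_pow_neg)
  finally have "s [^] nat g = \<one>"
    using g by (metis int_nat_eq int_pow_int less_imp_le)
  then have s: "s = \<one> \<or> s = e"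
    using torsion[OF sH, of "nat g"] g by simp
  have y_n': "y [^] n' = s \<otimes> d [^] m'"
    by (simp add: s_def m_assoc flip: int_pow_mult)
  \<comment> \<open>\<open>a\<close> goes with \<open>d\<close> and \<open>b\<close> with \<open>y\<close>, because \<open>d\<close> and \<open>y\<close> behave like the \<open>n'\<close>-th and \<open>m'\<close>-th powers of one
    element.\<close>
  define u where "u = d [^] a \<otimes> y [^] b"
  have uH: "u \<in> H" by (simp add: u_def)
  define s' where "s' = s [^] b"
  have s': "s' = \<one> \<or> s' = e"
  proof -
    have "s \<otimes> s = \<one>" using s e(2) by auto
    then have "s' [^] (2::nat) = \<one>"
      unfolding s'_def using sH
      by (simp add: numeral_2_eq_2 flip: int_pow_distrib)
    then show ?thesis using torsion[of s' 2] sH by (simp add: s'_def)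
  qed
  have "u [^] n' = d [^] (a * n') \<otimes> (y [^] n') [^] b"
    by (simp add: u_def int_pow_distrib int_pow_pow mult.commute)
  also have "\<dots> = d [^] (a * n') \<otimes> (s' \<otimes> d [^] (m' * b))"
    using sH by (simp add: y_n' int_pow_distrib int_pow_pow s'_def)
  also have "\<dots> = s' \<otimes> (d [^] (a * n') \<otimes> d [^] (m' * b))"
    using sH by (simp add: s'_def m_lcomm)
  also have "d [^] (a * n') \<otimes> d [^] (m' * b) = d"
    using ab by (simp add: mult.commute flip: int_pow_mult)
  finally have "u [^] n' = s' \<otimes> d" .
  then have "s' \<otimes> u [^] n' = (s' \<otimes> s') \<otimes> d"
    using sH by (simp add: s'_def m_assoc)
  moreover have "s' \<otimes> s' = \<one>" using s' e(2) by auto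
  ultimately have d_eq: "d = s' \<otimes> u [^] nat n'"
    using n' by (simp flip: int_pow_int)
  have "nat n' < 2"
  proof (rule ccontr)
    assume "\<not> nat n' < 2"
    then have r: "nat n' \<ge> 2" by simp
    have "s' \<noteq> \<one>"
      using d_eq not_power[OF uH r] uH by auto
    then have d_eq: "d = e \<otimes> u [^] nat n'" using d_eq s' by auto
    show False
    proof (cases "even (nat n')")
      case True
      then obtain k where "nat n' = k + k" by (metis evenE mult_2)
      then show False
        using d_eq not_square[of "u [^] k"] uH by (simp flip: nat_pow_mult)
    next
      case False
      then obtain k where k: "nat n' = Suc (2 * k)" by (metis oddE Suc_eq_plus1)
      have "e [^] nat n' = e"
        unfolding k using e(2) nat_pow_pow[of e 2 k] by (simp add: numeral_2_eq_2)
      then have "d = (e \<otimes> u) [^] nat n'"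
        using d_eq uH by (simp add: nat_pow_distrib)
      then show False using not_power[OF _ r, of "e \<otimes> u"] uH by simp
    qed
  qed
  then have "n' = 1" using n' by simp
  then show ?thesis using y_n' s by auto
qed

text \<open>The multiplication table is forced: the product of two distinct involutions is neither \<open>1\<close> nor one
  of the factors.\<close>

lemma (in group) klein_four_group:
  assumes car: "carrier G = {\<one>, a, b, c}" and dist: "distinct [\<one>, a, b, c]"
    and invol: "\<And>x. x \<in> carrier G \<Longrightarrow> x \<otimes> x = \<one>"
  shows "G \<cong> integer_mod_group 2 \<times>\<times> integer_mod_group 2"
proof -
  have third: "x \<otimes> y = z"
    if xyz: "{\<one>, x, y, z} = carrier G" "distinct [\<one>, x, y, z]" for x y z
  proof -
    have mem: "x \<in> carrier G" "y \<in> carrier G" using xyz(1) by auto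
    have "x \<otimes> y \<noteq> \<one>"
      using invol[OF mem(2)] mem xyz(2) right_cancel[of y x y] by auto
    moreover have "x \<otimes> y \<noteq> x" "x \<otimes> y \<noteq> y"
      using mem xyz(2) by (auto simp: r_cancel_one' l_cancel_one')
    ultimately show ?thesis using m_closed[OF mem] xyz(1) by blast
  qed
  have prods: "a \<otimes> b = c" "b \<otimes> a = c" "a \<otimes> c = b" "c \<otimes> a = b" "b \<otimes> c = a" "c \<otimes> b = a"
    by (rule third; use car dist in auto)+
  have sq: "a \<otimes> a = \<one>" "b \<otimes> b = \<one>" "c \<otimes> c = \<one>"
    and mem: "a \<in> carrier G" "b \<in> carrier G" "c \<in> carrier G"
    using invol car by auto
  define f :: "_ \<Rightarrow> int \<times> int" where
    "f x = (if x = a \<or> x = c then 1 else 0, if x = b \<or> x = c then 1 else 0)" for x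
  have f: "f \<one> = (0,0)" "f a = (1,0)" "f b = (0,1)" "f c = (1,1)"
    using dist by (auto simp: f_def)
  have "f \<in> iso G (integer_mod_group 2 \<times>\<times> integer_mod_group 2)"
  proof (rule isoI)
    show "f \<in> hom G (integer_mod_group 2 \<times>\<times> integer_mod_group 2)"
    proof (rule homI)
      fix x y assume "x \<in> carrier G" "y \<in> carrier G"
      then have "x \<in> {\<one>, a, b, c}" "y \<in> {\<one>, a, b, c}" using car by auto
      then show "f (x \<otimes> y) = f x \<otimes>\<^bsub>integer_mod_group 2 \<times>\<times> integer_mod_group 2\<^esub> f y"
        using mem by (auto simp: f prods sq)
    qed (auto simp: f_def carrier_integer_mod_group)
    have "{0..<2::int} = {0, 1}" by auto
    then show "bij_betw f (carrier G) (carrier (integer_mod_group 2 \<times>\<times> integer_mod_group 2))"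
      using dist unfolding bij_betw_def inj_on_def
      by (auto simp: car f carrier_integer_mod_group)
  qed
  then show ?thesis by (rule is_isoI)
qed

section \<open>Traces of powers\<close>

text \<open>By Cayley-Hamilton, \<open>U\<^sup>2 = tr(U) U - 1\<close> when \<open>det U = 1\<close>, so the traces of the powers of \<open>U\<close> satisfy the
  recurrence of the polynomials \<open>C\<^sub>n\<close> at \<open>tr U\<close>.\<close>

lemma trace_power_eq_C_poly:
  assumes "det U = 1"
  shows "trace (U [^]\<^bsub>nonsingular_R t\<^esub> (n::nat)) = C_poly n (trace U)"
proof (induction n rule: less_induct)
  case (less n)
  consider "n = 0" | "n = 1" | m where "n = Suc (Suc m)"
    by (metis One_nat_def old.nat.exhaust)
  then show ?case
  proof cases
    case (3 m)
    have "trace ((A ** U) ** U) = trace U * trace (A ** U) - trace A" for A :: rat_mat2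
    proof -
      have "trace ((A ** U) ** U) = trace U * trace (A ** U) - det U * trace A"
        by (simp add: trace_def sum_2 mat2_mult_nth det_2 algebra_simps)
      then show ?thesis using assms by simp
    qed
    then show ?thesis
      using less.IH[of m] less.IH[of "Suc m"]
      by (simp add: 3 C_poly_rec nonsingular_R_def)
  qed (simp_all add: C_poly_0 C_poly_1 C_poly_1[unfolded One_nat_def] nonsingular_R_def trace_I)
qed

lemma C_poly_gt_2:
  assumes "\<bar>z\<bar> > 2" "n > 0"
  shows "\<bar>C_poly n z\<bar> > 2"
proof -
  \<comment> \<open>The induction needs that the absolute values increase: then \<open>|z| |C\<^sub>m\<^sub>+\<^sub>1|\<close> outweighs \<open>|C\<^sub>m|\<close> in the
    recurrence.\<close>
  have "\<bar>C_poly (Suc m) z\<bar> > \<bar>C_poly m z\<bar> \<and> \<bar>C_poly (Suc m) z\<bar> > 2" for m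
  proof (induction m)
    case 0
    then show ?case using assms C_poly_1[of z] by (simp add: C_poly_0)
  next
    case (Suc m)
    have "\<bar>z\<bar> * \<bar>C_poly (Suc m) z\<bar> \<ge> 2 * \<bar>C_poly (Suc m) z\<bar>"
      using assms by (intro mult_right_mono) auto
    moreover have "\<bar>z\<bar> * \<bar>C_poly (Suc m) z\<bar> - \<bar>C_poly m z\<bar> \<le> \<bar>C_poly (Suc (Suc m)) z\<bar>"
      unfolding C_poly_rec abs_mult[symmetric] by (rule abs_triangle_ineq2)
    ultimately show ?case using Suc.IH by linarith
  qed
  then show ?thesis using assms(2) by (metis gr0_implies_Suc)
qed

text \<open>This expresses that \<open>C\<^sub>n\<close> is monic with integer coefficients for \<open>n \<ge> 1\<close>, in the form needed for the
  rational root argument: at \<open>z = p / q\<close> the numerator over \<open>q\<^sup>n\<close> is congruent to \<open>p\<^sup>n\<close> modulo \<open>q\<close>. The index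
  starts at 1 because \<open>C\<^sub>0 = 2\<close> is not monic.\<close>

lemma C_poly_numerator_cong:
  fixes p q :: int
  assumes "z * of_int q = of_int p"
  shows "\<exists>a::int. C_poly (Suc n) z * of_int q ^ Suc n = of_int (p ^ Suc n + q * a)"
proof (induction n rule: less_induct)
  case (less n)
  consider "n = 0" | "n = 1" | m where "n = Suc (Suc m)"
    by (metis One_nat_def old.nat.exhaust)
  then show ?case
  proof cases
    case 1
    then show ?thesis using assms C_poly_1[of z] by (auto intro!: exI[of _ 0])
  next
    case 2
    \<comment> \<open>The recurrence for \<open>C\<^sub>2\<close> involves \<open>C\<^sub>0\<close>, to which the induction hypothesis does not apply.\<close>
    have "C_poly 2 z = z * z - 2"
      using C_poly_rec[of 0 z] C_poly_1[of z] by (simp add: C_poly_0 numeral_2_eq_2)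
    then have "C_poly 2 z * of_int q ^ 2 = (z * of_int q) ^ 2 - 2 * of_int q ^ 2"
      by (simp only:) (simp add: power2_eq_square algebra_simps)
    then have "C_poly 2 z * of_int q ^ 2 = of_int (p ^ 2 + q * (- 2 * q))"
      unfolding assms by (simp add: power2_eq_square)
    then show ?thesis unfolding 2 by (metis Suc_1)
  next
    case (3 m)
    obtain a where a: "C_poly (Suc m) z * of_int q ^ Suc m = of_int (p ^ Suc m + q * a)"
      using less.IH[of m] 3 by auto
    obtain b where b: "C_poly (Suc (Suc m)) z * of_int q ^ Suc (Suc m) = of_int (p ^ Suc (Suc m) + q * b)"
      using less.IH[of "Suc m"] 3 by auto
    have "C_poly (Suc n) z * of_int q ^ Suc n =
        (z * of_int q) * (C_poly (Suc (Suc m)) z * of_int q ^ Suc (Suc m))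
        - of_int q ^ 2 * (C_poly (Suc m) z * of_int q ^ Suc m)"
      unfolding 3 C_poly_rec[of "Suc m"] by (simp add: power2_eq_square algebra_simps)
    also have "\<dots> = of_int (p ^ Suc n + q * (p * b - q * (p ^ Suc m + q * a)))"
      unfolding assms a b 3 by (simp add: power2_eq_square algebra_simps)
    finally show ?thesis by blast
  qed
qed

text \<open>The value 2 is the trace of the identity, so these \<open>z\<close> are the possible rational traces of norm-one
  elements of finite order: integrality comes from the denominator, the bound from the growth of
  \<open>C\<^sub>n\<close>.\<close>

lemma C_poly_eq_2_cases:
  assumes "C_poly n z = 2" "n > 0"
  shows "z \<in> {-2, -1, 0, 1, 2}"
proof -
  obtain p q where pq: "quotient_of z = (p, q)" by fastforce
  then have q: "q > 0" "coprime p q" "z = of_int p / of_int q"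
    using quotient_of_denom_pos quotient_of_coprime quotient_of_div by blast+
  obtain m where m: "n = Suc m" using assms(2) gr0_implies_Suc by blast
  obtain a where "C_poly n z * of_int q ^ n = of_int (p ^ n + q * a)"
    using C_poly_numerator_cong[of z q p m] q unfolding m by auto
  then have "(of_int (2 * q ^ n) :: rat) = of_int (p ^ n + q * a)"
    using assms by simp
  then have "2 * q ^ n = p ^ n + q * a" by (simp only: of_int_eq_iff)
  then have "p ^ n = q * (2 * q ^ m - a)" by (simp add: m algebra_simps)
  then have "q dvd p ^ n" by simp
  moreover have "coprime q (p ^ n)"
    using q(2) by (simp add: coprime_commute)
  ultimately have "q = 1" using q(1)
    by (metis coprime_common_divisor dvd_refl zdvd1_eq abs_of_pos)
  moreover have "\<bar>z\<bar> \<le> 2"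
    using C_poly_gt_2[of z n] assms by force
  ultimately have "\<bar>p\<bar> \<le> 2" "z = of_int p"
    using q(3) by auto
  moreover from this(1) have "p \<in> {-2, -1, 0, 1, 2}" by auto
  ultimately show ?thesis by auto
qed

section \<open>Elements of norm one\<close>

lemma not_cyclotomic_imp_square_neq_4:
  assumes "\<not> cyclotomic t"
  shows "t ^ 2 \<noteq> 4"
  using assms unfolding cyclotomic_def circular_def by (auto intro: exI[of _ 0])

text \<open>For \<open>Z = [a b]\<close> of norm one the discriminant \<open>z\<^sup>2 - 4\<close> of its characteristic polynomial is
  \<open>a\<^sup>2 (t\<^sup>2 - 4)\<close>. Trace \<open>0\<close> therefore makes \<open>t\<close> circular, trace \<open>\<plusminus>1\<close> makes \<open>t\<close> cubic, and trace \<open>\<plusminus>2\<close> leaves only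
  \<open>a = 0\<close>, a scalar.\<close>

lemma norm_one_torsion:
  assumes t: "\<not> cyclotomic t" and Z: "Z \<in> carrier (nonsingular_R t)" "det Z = 1"
    and n: "Z [^]\<^bsub>nonsingular_R t\<^esub> n = mat 1" "n > (0::nat)"
  shows "Z = mat 1 \<or> Z = mat (-1)"
proof -
  obtain a b where ab: "Z = elt t a b"
    using Z by (auto simp: nonsingular_R_def carrier_comm_ring_R)
  define z where "z = trace Z"
  have z: "z = 2 * b - t * a"
    by (simp add: z_def ab trace_def sum_2 elt_nth)
  have det: "b ^ 2 - t * a * b + a ^ 2 = 1"
    using Z(2) by (simp add: ab det_elt)
  have disc: "z ^ 2 - 4 = a ^ 2 * (t ^ 2 - 4)"
  proof -
    have "z ^ 2 - 4 * (b ^ 2 - t * a * b + a ^ 2) = a ^ 2 * (t ^ 2 - 4)"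
      unfolding z by (simp add: power2_eq_square algebra_simps)
    then show ?thesis unfolding det by simp
  qed
  have "C_poly n z = 2"
    using trace_power_eq_C_poly[OF Z(2), of t n] n
    by (simp add: z_def trace_def sum_2 mat_def)
  then have "z \<in> {-2, -1, 0, 1, 2}" using C_poly_eq_2_cases n(2) by blast
  then consider "z ^ 2 = 4" | "z ^ 2 = 1" | "z ^ 2 = 0" by fastforce
  then have "a = 0"
  proof cases
    case 1
    then show ?thesis using disc not_cyclotomic_imp_square_neq_4[OF t] by simp
  next
    case 2
    then have eq: "a ^ 2 * (t ^ 2 - 4) = - 3" using disc by simp
    then have "a \<noteq> 0" by auto
    then have "t ^ 2 - 4 = - 3 * (1 / a) ^ 2"
      using eq by (simp add: field_simps)
    then show ?thesis using t unfolding cyclotomic_def cubic_def by blast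
  next
    case 3
    then have eq: "a ^ 2 * (t ^ 2 - 4) = - 4" using disc by simp
    then have "a \<noteq> 0" by auto
    then have "t ^ 2 - 4 = - ((2 / a) ^ 2)"
      using eq by (simp add: field_simps)
    then show ?thesis using t unfolding cyclotomic_def circular_def by blast
  qed
  with det have "b = 1 \<or> b = -1" by (simp add: power2_eq_1_iff)
  then show ?thesis using \<open>a = 0\<close> by (auto simp: ab mat2_eq_iff elt_nth mat2_nth)
qed

section \<open>The quotient of a matrix by its conjugate\<close>

text \<open>With \<open>X'\<close> the adjugate of \<open>X\<close>, which is its conjugate in \<open>\<R>(t)\<close>, \<open>X X' = det X\<close> and hence
  \<open>X / X' = X\<^sup>2 / det X\<close>.\<close>

definition conj_ratio :: "rat_mat2 \<Rightarrow> rat_mat2" where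
  "conj_ratio X = mat (1 / det X) ** (X ** X)"

lemma scalar_mult_nth: "(mat c ** (X :: rat_mat2))$i$j = c * X$i$j"
  using exhaust_2[of i] by (auto simp: mat2_mult_nth mat_def)

lemma scalar_mult_assoc:
  fixes X Y :: rat_mat2
  shows "(mat a ** X) ** (mat b ** Y) = mat (a * b) ** (X ** Y)"
  by (simp add: mat2_eq_iff mat2_mult_nth mat2_nth algebra_simps)

lemma scalar_mult_elt: "mat c ** elt t a b = elt t (c * a) (c * b)"
  by (simp add: mat2_eq_iff scalar_mult_nth elt_nth algebra_simps)

lemma scalar_in_nonsingular_R: "c \<noteq> 0 \<Longrightarrow> mat c \<in> carrier (nonsingular_R t)"
  using subgroup.subset[OF subgroup_scalar_mats] by (auto simp: scalar_mats_def)

lemma mult_nonsingular_R [simp]: "X \<otimes>\<^bsub>nonsingular_R t\<^esub> Y = X ** Y"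
  and one_nonsingular_R [simp]: "\<one>\<^bsub>nonsingular_R t\<^esub> = mat 1"
  by (simp_all add: nonsingular_R_def)

lemma elt_in_nonsingular_R_iff: "elt t a b \<in> carrier (nonsingular_R t) \<longleftrightarrow> det (elt t a b) \<noteq> 0"
  by (auto simp: nonsingular_R_def carrier_comm_ring_R)

lemma det_scalar: "det (mat c :: rat_mat2) = c * c"
  by (simp add: det_2 mat2_nth)

lemma det_D_mat: "det (D_mat t) = 1"
  by (simp add: D_mat_eq_elt det_elt power2_eq_square)

lemma det_conj_ratio: "det X \<noteq> 0 \<Longrightarrow> det (conj_ratio X) = 1"
  by (simp add: conj_ratio_def det_mul det_scalar)

lemma conj_ratio_hom: "group_hom (nonsingular_R t) (nonsingular_R t) conj_ratio"
proof -
  interpret N: comm_group "nonsingular_R t" by (rule comm_group_nonsingular_R)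
  show ?thesis
  proof (unfold_locales, rule homI)
    fix X assume "X \<in> carrier (nonsingular_R t)"
    moreover from this have "det X \<noteq> 0" by (simp add: nonsingular_R_def)
    ultimately show "conj_ratio X \<in> carrier (nonsingular_R t)"
      unfolding conj_ratio_def
      by (metis N.m_closed mult_nonsingular_R scalar_in_nonsingular_R divide_eq_0_iff one_neq_zero)
  next
    fix X Y assume XY: "X \<in> carrier (nonsingular_R t)" "Y \<in> carrier (nonsingular_R t)"
    have "Y ** X = X ** Y" using N.m_comm[OF XY] by simp
    then have "(X ** Y) ** (X ** Y) = (X ** X) ** (Y ** Y)" by (metis matrix_mul_assoc)
    then show "conj_ratio (X \<otimes>\<^bsub>nonsingular_R t\<^esub> Y) = conj_ratio X \<otimes>\<^bsub>nonsingular_R t\<^esub> conj_ratio Y"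
      by (simp add: conj_ratio_def det_mul scalar_mult_assoc)
  qed
qed

text \<open>An element equals its conjugate exactly when it is rational. For \<open>X = [a b]\<close> this is a comparison of
  the entries of \<open>X\<^sup>2\<close> with \<open>det X\<close>, in which \<open>a \<noteq> 0\<close> would make \<open>X\<close> singular.\<close>

lemma conj_ratio_eq_one_iff:
  assumes "X \<in> carrier (nonsingular_R t)"
  shows "conj_ratio X = mat 1 \<longleftrightarrow> X \<in> scalar_mats"
proof
  obtain a b where X: "X = elt t a b" and det: "det X \<noteq> 0"
    using assms by (auto simp: nonsingular_R_def carrier_comm_ring_R)
  assume "conj_ratio X = mat 1"
  then have "elt t (1 / det X * (a * b + b * a - t * a * a)) (1 / det X * (b * b - a * a)) = elt t 0 1"
    by (simp add: conj_ratio_def X elt_mult scalar_mult_elt one_eq_elt)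
  then have "a * b + b * a - t * a * a = 0" and ratio: "b * b - a * a = det X"
    using det by (auto simp: mat2_eq_iff elt_nth field_simps)
  moreover have "a * (2 * b - t * a) = a * b + b * a - t * a * a"
      "a * (2 * a - t * b) = det X - (b * b - a * a)"
    by (simp_all add: X det_elt power2_eq_square algebra_simps)
  ultimately have "a * (2 * b - t * a) = 0" "a * (2 * a - t * b) = 0" by simp_all
  then have "a = 0 \<or> 2 * b = t * a" "a = 0 \<or> 2 * a = t * b"
    by (simp_all only: mult_eq_0_iff right_minus_eq)
  moreover have False if "2 * b = t * a" "2 * a = t * b"
  proof -
    have "2 * (b * b) = 2 * (a * a)"
      using that by (metis mult.assoc mult.commute)
    then have "det X = 0" using ratio by linarith
    then show False using det by simp
  qed
  ultimately have "a = 0" by blast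
  then have "X = mat b" "b \<noteq> 0"
    using det by (auto simp: X mat2_eq_iff elt_nth mat2_nth det_elt)
  then show "X \<in> scalar_mats" by (auto simp: scalar_mats_def)
next
  assume "X \<in> scalar_mats"
  then show "conj_ratio X = mat 1"
    by (auto simp: scalar_mats_def conj_ratio_def mat2_eq_iff scalar_mult_nth mat2_mult_nth mat2_nth det_2)
qed

lemma conj_ratio_elt:
  "conj_ratio (elt t a b) =
     elt t ((2 * b - t * a) * a / det (elt t a b)) ((b ^ 2 - a ^ 2) / det (elt t a b))"
  by (simp add: conj_ratio_def elt_mult scalar_mult_elt power2_eq_square algebra_simps diff_divide_distrib)

section \<open>Laxton classes\<close>

lemma (in group) coset_eq_self_iff:
  "subgroup H G \<Longrightarrow> x \<in> carrier G \<Longrightarrow> H #> x = H \<longleftrightarrow> x \<in> H"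
  using coset_join1 coset_join2 by metis

lemma (in group_hom) hom_eq_iff_quotient:
  "x \<in> carrier G \<Longrightarrow> y \<in> carrier G \<Longrightarrow> h x = h y \<longleftrightarrow> h (x \<otimes> inv y) = \<one>\<^bsub>H\<^esub>"
  by (simp add: H.inv_solve_right')

lemma laxton_class_hom: "group_hom (nonsingular_R t) (laxton_group t) (laxton_class t)"
  and laxton_class_surj: "carrier (laxton_group t) = laxton_class t ` carrier (nonsingular_R t)"
proof -
  interpret N: comm_group "nonsingular_R t" by (rule comm_group_nonsingular_R)
  interpret L: comm_group "seq_group t" by (rule comm_group_seq_group)
  interpret A: comm_group "laxton_group t" by (rule comm_group_laxton_group)
  interpret S: normal scalar_mats "nonsingular_R t"
    by (rule N.subgroup_imp_normal[OF subgroup_scalar_mats])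
  interpret DS: normal "D_subgroup t" "seq_group t"
    by (rule L.subgroup_imp_normal[OF subgroup_D_subgroup])
  have "(\<lambda>X. D_subgroup t #>\<^bsub>seq_group t\<^esub> X) \<circ> (\<lambda>X. scalar_mats #>\<^bsub>nonsingular_R t\<^esub> X)
      \<in> hom (nonsingular_R t) (laxton_group t)"
    unfolding laxton_group_def
    by (rule hom_compose[OF _ DS.r_coset_hom_Mod]) (unfold seq_group_def, rule S.r_coset_hom_Mod)
  then show "group_hom (nonsingular_R t) (laxton_group t) (laxton_class t)"
    by unfold_locales (simp add: o_def laxton_class_def[abs_def] seq_class_def)
  show "carrier (laxton_group t) = laxton_class t ` carrier (nonsingular_R t)"
    by (simp add: laxton_group_def carrier_FactGroup laxton_class_def seq_class_def
        seq_group_def[of t, THEN arg_cong[where f = carrier]] image_image)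
qed

text \<open>A trivial Laxton class means \<open>X = cD\<^sup>k\<close> with a scalar \<open>c\<close>. The ratio removes \<open>c\<close> and loses nothing else, and
  the ratio of \<open>D\<close> is \<open>D\<^sup>2\<close> since \<open>det D = 1\<close>.\<close>

lemma laxton_class_eq_one_iff:
  assumes X: "X \<in> carrier (nonsingular_R t)"
  shows "laxton_class t X = \<one>\<^bsub>laxton_group t\<^esub> \<longleftrightarrow>
    (\<exists>k::int. conj_ratio X = D_mat t [^]\<^bsub>nonsingular_R t\<^esub> (2 * k))"
proof -
  interpret N: comm_group "nonsingular_R t" by (rule comm_group_nonsingular_R)
  interpret L: comm_group "seq_group t" by (rule comm_group_seq_group)
  interpret S: normal scalar_mats "nonsingular_R t"
    by (rule N.subgroup_imp_normal[OF subgroup_scalar_mats])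
  interpret DS: normal "D_subgroup t" "seq_group t"
    by (rule L.subgroup_imp_normal[OF subgroup_D_subgroup])
  interpret s: group_hom "nonsingular_R t" "seq_group t" "seq_class t"
    using S.r_coset_hom_Mod
    by unfold_locales (simp add: seq_group_def seq_class_def[abs_def])
  interpret q: group_hom "nonsingular_R t" "nonsingular_R t" conj_ratio
    by (rule conj_ratio_hom)
  note D = D_mat_in_nonsingular_R[of t]
  have qD: "conj_ratio (D_mat t) = D_mat t [^]\<^bsub>nonsingular_R t\<^esub> (2::int)"
    using D N.int_pow_mult[OF D, of 1 1]
    by (simp add: conj_ratio_def det_D_mat)
  have one: "\<one>\<^bsub>seq_group t\<^esub> = scalar_mats" by (simp add: seq_group_def)
  have "laxton_class t X = \<one>\<^bsub>laxton_group t\<^esub> \<longleftrightarrow> seq_class t X \<in> D_subgroup t"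
    unfolding laxton_class_def laxton_group_def one_FactGroup
    by (rule L.coset_eq_self_iff[OF subgroup_D_subgroup s.hom_closed[OF X]])
  also have "\<dots> \<longleftrightarrow> (\<exists>k::int. seq_class t X = seq_class t (D_mat t [^]\<^bsub>nonsingular_R t\<^esub> k))"
    using D by (simp add: D_subgroup_def L.generate_pow s.hom_int_pow)
  also have "\<dots> \<longleftrightarrow> (\<exists>k::int. conj_ratio X = D_mat t [^]\<^bsub>nonsingular_R t\<^esub> (2 * k))"
  proof (rule ex_cong1)
    fix k :: int
    let ?Dk = "D_mat t [^]\<^bsub>nonsingular_R t\<^esub> k"
    let ?Z = "X \<otimes>\<^bsub>nonsingular_R t\<^esub> inv\<^bsub>nonsingular_R t\<^esub> ?Dk"
    have Z: "?Z \<in> carrier (nonsingular_R t)" using X D by (simp del: mult_nonsingular_R)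
    have "seq_class t X = seq_class t ?Dk \<longleftrightarrow> seq_class t ?Z = \<one>\<^bsub>seq_group t\<^esub>"
      using X D by (intro s.hom_eq_iff_quotient) auto
    also have "\<dots> \<longleftrightarrow> ?Z \<in> scalar_mats"
      unfolding one seq_class_def
      by (rule N.coset_eq_self_iff[OF subgroup_scalar_mats Z])
    also have "\<dots> \<longleftrightarrow> conj_ratio ?Z = \<one>\<^bsub>nonsingular_R t\<^esub>"
      using conj_ratio_eq_one_iff[OF Z] by simp
    also have "\<dots> \<longleftrightarrow> conj_ratio X = conj_ratio ?Dk"
      using X D by (intro q.hom_eq_iff_quotient[symmetric]) auto
    also have "conj_ratio ?Dk = D_mat t [^]\<^bsub>nonsingular_R t\<^esub> (2 * k)"
      using D by (simp add: q.hom_int_pow qD N.int_pow_pow)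
    finally show "seq_class t X = seq_class t ?Dk \<longleftrightarrow> conj_ratio X = D_mat t [^]\<^bsub>nonsingular_R t\<^esub> (2 * k)" .
  qed
  finally show ?thesis .
qed

lemma laxton_class_eq_iff:
  assumes X: "X \<in> carrier (nonsingular_R t)" and Y: "Y \<in> carrier (nonsingular_R t)"
  shows "laxton_class t X = laxton_class t Y \<longleftrightarrow>
    (\<exists>k::int. conj_ratio X = D_mat t [^]\<^bsub>nonsingular_R t\<^esub> (2 * k) ** conj_ratio Y)"
proof -
  interpret N: comm_group "nonsingular_R t" by (rule comm_group_nonsingular_R)
  interpret h: group_hom "nonsingular_R t" "laxton_group t" "laxton_class t"
    by (rule laxton_class_hom)
  interpret q: group_hom "nonsingular_R t" "nonsingular_R t" conj_ratio
    by (rule conj_ratio_hom)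
  let ?Z = "X \<otimes>\<^bsub>nonsingular_R t\<^esub> inv\<^bsub>nonsingular_R t\<^esub> Y"
  have Z: "?Z \<in> carrier (nonsingular_R t)"
    using X Y by (intro N.m_closed N.inv_closed)
  have "laxton_class t X = laxton_class t Y \<longleftrightarrow> laxton_class t ?Z = \<one>\<^bsub>laxton_group t\<^esub>"
    using X Y by (rule h.hom_eq_iff_quotient)
  also have "\<dots> \<longleftrightarrow> (\<exists>k::int. conj_ratio ?Z = D_mat t [^]\<^bsub>nonsingular_R t\<^esub> (2 * k))"
    by (rule laxton_class_eq_one_iff[OF Z])
  also have "\<dots> \<longleftrightarrow> (\<exists>k::int. conj_ratio X =
      D_mat t [^]\<^bsub>nonsingular_R t\<^esub> (2 * k) \<otimes>\<^bsub>nonsingular_R t\<^esub> conj_ratio Y)"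
  proof (rule ex_cong1)
    fix k :: int
    let ?P = "D_mat t [^]\<^bsub>nonsingular_R t\<^esub> (2 * k)"
    have "conj_ratio ?Z = conj_ratio X \<otimes>\<^bsub>nonsingular_R t\<^esub> inv\<^bsub>nonsingular_R t\<^esub> conj_ratio Y"
      using q.hom_mult[OF X N.inv_closed[OF Y]] q.hom_inv[OF Y] by (simp only:)
    moreover have "?P \<in> carrier (nonsingular_R t)"
      by (rule N.int_pow_closed[OF D_mat_in_nonsingular_R])
    ultimately show "conj_ratio ?Z = ?P \<longleftrightarrow> conj_ratio X = ?P \<otimes>\<^bsub>nonsingular_R t\<^esub> conj_ratio Y"
      using N.inv_solve_right'[of ?P "conj_ratio X" "conj_ratio Y"] q.hom_closed[OF X] q.hom_closed[OF Y]
      by (simp only:)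
  qed
  finally show ?thesis by (simp only: mult_nonsingular_R)
qed

section \<open>Torsion in the Laxton group\<close>

text \<open>With \<open>\<epsilon> = \<plusminus>1\<close> these are the possible ratios \<open>\<plusminus>D\<^sup>k\<close> of torsion elements; only the sign and the parity of \<open>k\<close> survive in
  the Laxton group.\<close>

definition signed_power :: "rat \<Rightarrow> rat \<Rightarrow> int \<Rightarrow> rat_mat2" where
  "signed_power t \<epsilon> k = mat \<epsilon> ** D_mat t [^]\<^bsub>nonsingular_R t\<^esub> k"

text \<open>Taking traces turns the hypotheses on \<open>t\<close> into statements about roots of \<open>D\<close>: \<open>D = U\<^sup>r\<close> gives
  \<open>t = C\<^sub>r(tr U)\<close>, and \<open>D = -U\<^sup>2\<close> gives \<open>-t = C\<^sub>2(tr U)\<close>.\<close>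

lemma primitive_norm_one_root:
  assumes prim: "primitive t" and twin: "r_primitive 2 (- t)" and cyc: "\<not> cyclotomic t"
    and Y: "Y \<in> carrier (nonsingular_R t)" "det Y = 1"
      "Y [^]\<^bsub>nonsingular_R t\<^esub> n = D_mat t [^]\<^bsub>nonsingular_R t\<^esub> (M::int)" "n > (0::nat)"
  obtains \<epsilon> k where "\<epsilon> \<in> {1, -1}" "Y = signed_power t \<epsilon> k"
proof -
  interpret N: comm_group "nonsingular_R t" by (rule comm_group_nonsingular_R)
  let ?H = "{X \<in> carrier (nonsingular_R t). det X = 1}"
  have H: "subgroup ?H (nonsingular_R t)"
  proof (rule N.subgroupI)
    show "?H \<noteq> {}" using N.one_closed by (auto intro!: exI[of _ "mat 1"])
  next
    fix X assume X: "X \<in> ?H"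
    then have "det (inv\<^bsub>nonsingular_R t\<^esub> X ** X) = 1"
      using N.l_inv[of X] by (simp del: N.l_inv)
    then show "inv\<^bsub>nonsingular_R t\<^esub> X \<in> ?H" using X by (simp add: det_mul)
  next
    fix X X' assume "X \<in> ?H" "X' \<in> ?H"
    then show "X \<otimes>\<^bsub>nonsingular_R t\<^esub> X' \<in> ?H"
      using N.m_closed[of X X'] by (simp add: det_mul)
  qed auto
  have traceD: "trace (D_mat t) = t" by (simp add: trace_def sum_2 D_mat_def vector_2)
  have "\<exists>k::int. Y = D_mat t [^]\<^bsub>nonsingular_R t\<^esub> k \<or>
      Y = mat (-1) \<otimes>\<^bsub>nonsingular_R t\<^esub> D_mat t [^]\<^bsub>nonsingular_R t\<^esub> k"
  proof (rule N.root_of_power_in_powers[OF H])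
    show "mat (-1) \<in> ?H" by (simp add: scalar_in_nonsingular_R det_scalar)
    show "mat (-1) \<otimes>\<^bsub>nonsingular_R t\<^esub> mat (-1) = \<one>\<^bsub>nonsingular_R t\<^esub>"
      by (simp add: mat2_eq_iff scalar_mult_nth mat2_nth)
    show "D_mat t \<in> ?H" by (simp add: D_mat_in_nonsingular_R det_D_mat)
    show "Y \<in> ?H" using Y by simp
    show "Z = \<one>\<^bsub>nonsingular_R t\<^esub> \<or> Z = mat (-1)"
      if "Z \<in> ?H" "m > (0::nat)" "Z [^]\<^bsub>nonsingular_R t\<^esub> m = \<one>\<^bsub>nonsingular_R t\<^esub>" for Z m
      using norm_one_torsion[OF cyc, of Z m] that by simp
    show "D_mat t \<noteq> U [^]\<^bsub>nonsingular_R t\<^esub> r" if U: "U \<in> ?H" and r: "r \<ge> (2::nat)" for U r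
    proof
      assume "D_mat t = U [^]\<^bsub>nonsingular_R t\<^esub> r"
      then have "t = C_poly r (trace U)"
        using trace_power_eq_C_poly[of U t r] U traceD by simp
      then show False using prim r by (auto simp: primitive_def r_primitive_def)
    qed
    show "D_mat t \<noteq> mat (-1) \<otimes>\<^bsub>nonsingular_R t\<^esub> (U \<otimes>\<^bsub>nonsingular_R t\<^esub> U)" if U: "U \<in> ?H" for U
    proof
      assume "D_mat t = mat (-1) \<otimes>\<^bsub>nonsingular_R t\<^esub> (U \<otimes>\<^bsub>nonsingular_R t\<^esub> U)"
      then have "t = trace (mat (-1) ** (U ** U))" using traceD by simp
      then have "- t = trace (U ** U)"
        by (simp add: trace_def sum_2 scalar_mult_nth)
      also have "\<dots> = C_poly 2 (trace U)"
        using trace_power_eq_C_poly[of U t 2] U by (simp add: numeral_2_eq_2)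
      finally show False using twin by (auto simp: r_primitive_def)
    qed
  qed (use Y in auto)
  then obtain k :: int where "Y = D_mat t [^]\<^bsub>nonsingular_R t\<^esub> k \<or>
      Y = mat (-1) ** D_mat t [^]\<^bsub>nonsingular_R t\<^esub> k" by auto
  then have "Y = signed_power t 1 k \<or> Y = signed_power t (-1) k"
    by (simp add: signed_power_def)
  then show ?thesis using that[of 1 k] that[of "-1" k] by auto
qed

lemma D_power_mult_signed_power:
  assumes "\<epsilon> \<noteq> 0"
  shows "D_mat t [^]\<^bsub>nonsingular_R t\<^esub> k ** signed_power t \<epsilon> j = signed_power t \<epsilon> (k + j)"
proof -
  interpret N: comm_group "nonsingular_R t" by (rule comm_group_nonsingular_R)
  have "D_mat t [^]\<^bsub>nonsingular_R t\<^esub> k \<otimes>\<^bsub>nonsingular_R t\<^esub>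
        (mat \<epsilon> \<otimes>\<^bsub>nonsingular_R t\<^esub> D_mat t [^]\<^bsub>nonsingular_R t\<^esub> j)
      = mat \<epsilon> \<otimes>\<^bsub>nonsingular_R t\<^esub> D_mat t [^]\<^bsub>nonsingular_R t\<^esub> (k + j)"
    using D_mat_in_nonsingular_R[of t] scalar_in_nonsingular_R[OF assms, of t]
    by (simp add: N.int_pow_mult N.m_ac del: mult_nonsingular_R)
  then show ?thesis by (simp add: signed_power_def)
qed

text \<open>\<open>D\<close> has infinite order modulo \<open>\<plusminus>1\<close>: otherwise it would itself be torsion of norm one, hence
  \<open>\<plusminus>1\<close>, but it is not a scalar.\<close>

lemma D_power_eq_sign_imp_zero:
  assumes cyc: "\<not> cyclotomic t"
    and pow: "D_mat t [^]\<^bsub>nonsingular_R t\<^esub> (k::int) = mat \<epsilon>" and sgn: "\<epsilon> \<in> {1, -1}"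
  shows "k = 0"
proof (rule ccontr)
  interpret N: comm_group "nonsingular_R t" by (rule comm_group_nonsingular_R)
  note D = D_mat_in_nonsingular_R[of t]
  assume "k \<noteq> 0"
  have "D_mat t [^]\<^bsub>nonsingular_R t\<^esub> (k + k) = mat \<epsilon> ** mat \<epsilon>"
    using N.int_pow_mult[OF D, of k k] by (simp only: pow mult_nonsingular_R)
  also have "\<dots> = mat 1"
    using sgn by (auto simp: mat2_eq_iff scalar_mult_nth mat2_nth)
  \<comment> \<open>Raising to the power \<open>k\<close> once more makes the exponent positive whatever the sign of \<open>k\<close>.\<close>
  finally have "D_mat t [^]\<^bsub>nonsingular_R t\<^esub> ((k + k) * k) = mat 1"
    using D N.int_pow_one[of k] by (simp flip: N.int_pow_pow)
  moreover have pos: "(k + k) * k > 0"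
    using \<open>k \<noteq> 0\<close> by (simp add: zero_less_mult_iff) linarith
  ultimately have "D_mat t [^]\<^bsub>nonsingular_R t\<^esub> nat ((k + k) * k) = mat 1"
    by (metis int_nat_eq int_pow_int less_imp_le)
  then have "D_mat t = mat 1 \<or> D_mat t = mat (-1)"
    using norm_one_torsion[OF cyc D det_D_mat] pos by (metis zero_less_nat_eq)
  then show False by (auto simp: mat2_eq_iff D_mat_eq_elt elt_nth mat2_nth)
qed

lemma signed_power_inj:
  assumes cyc: "\<not> cyclotomic t" and eq: "signed_power t \<epsilon> i = signed_power t \<delta> j"
    and sgn: "\<epsilon> \<in> {1, -1}" "\<delta> \<in> {1, -1}"
  shows "\<epsilon> = \<delta> \<and> i = j"
proof -
  have "signed_power t \<epsilon> (- j + i) = signed_power t \<delta> (- j + j)"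
    using eq D_power_mult_signed_power[of \<epsilon> t "- j" i]
      D_power_mult_signed_power[of \<delta> t "- j" j] sgn by auto
  then have "mat \<epsilon> ** (mat \<epsilon> ** D_mat t [^]\<^bsub>nonsingular_R t\<^esub> (i - j)) = mat \<epsilon> ** mat \<delta>"
    by (simp add: signed_power_def)
  then have pow: "D_mat t [^]\<^bsub>nonsingular_R t\<^esub> (i - j) = mat (\<epsilon> * \<delta>)"
    using sgn by (auto simp: mat2_eq_iff scalar_mult_nth mat2_nth)
  then have ij: "i = j"
    using D_power_eq_sign_imp_zero[OF cyc pow] sgn by auto
  then have "mat (\<epsilon> * \<delta>) = (mat 1 :: rat_mat2)" using pow by simp
  then have "\<epsilon> * \<delta> = 1" by (simp add: mat2_eq_iff mat2_nth)
  then show ?thesis using sgn ij by auto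
qed

lemma laxton_class_eq_iff_sign_parity:
  assumes cyc: "\<not> cyclotomic t"
    and "X \<in> carrier (nonsingular_R t)" "Y \<in> carrier (nonsingular_R t)"
    and "conj_ratio X = signed_power t \<epsilon> i" "conj_ratio Y = signed_power t \<delta> j"
    and sgn: "\<epsilon> \<in> {1, -1}" "\<delta> \<in> {1, -1}"
  shows "laxton_class t X = laxton_class t Y \<longleftrightarrow> \<epsilon> = \<delta> \<and> even (i - j)"
proof -
  have "\<delta> \<noteq> 0" using sgn by auto
  then have "laxton_class t X = laxton_class t Y \<longleftrightarrow>
      (\<exists>k. signed_power t \<epsilon> i = signed_power t \<delta> (2 * k + j))"
    unfolding laxton_class_eq_iff[OF assms(2,3)] assms(4,5)
    by (simp add: D_power_mult_signed_power)
  also have "\<dots> \<longleftrightarrow> (\<exists>k. \<epsilon> = \<delta> \<and> i = 2 * k + j)"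
    using signed_power_inj[OF cyc] sgn by blast
  also have "\<dots> \<longleftrightarrow> \<epsilon> = \<delta> \<and> even (i - j)"
    by (simp only: dvd_def diff_eq_eq ex_simps)
  finally show ?thesis .
qed

lemma laxton_class_square_eq_one:
  assumes X: "X \<in> carrier (nonsingular_R t)"
    and r: "conj_ratio X = signed_power t \<epsilon> k" "\<epsilon> \<in> {1, -1}"
  shows "laxton_class t X \<otimes>\<^bsub>laxton_group t\<^esub> laxton_class t X = \<one>\<^bsub>laxton_group t\<^esub>"
proof -
  interpret N: comm_group "nonsingular_R t" by (rule comm_group_nonsingular_R)
  interpret h: group_hom "nonsingular_R t" "laxton_group t" "laxton_class t"
    by (rule laxton_class_hom)
  interpret q: group_hom "nonsingular_R t" "nonsingular_R t" conj_ratio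
    by (rule conj_ratio_hom)
  have "conj_ratio (X ** X) = signed_power t \<epsilon> k ** signed_power t \<epsilon> k"
    using q.hom_mult[OF X X] r by simp
  also have "\<dots> = mat \<epsilon> ** (D_mat t [^]\<^bsub>nonsingular_R t\<^esub> k ** signed_power t \<epsilon> k)"
    by (simp add: signed_power_def matrix_mul_assoc)
  also have "\<dots> = mat \<epsilon> ** signed_power t \<epsilon> (k + k)"
    using r(2) by (subst D_power_mult_signed_power) auto
  also have "\<dots> = D_mat t [^]\<^bsub>nonsingular_R t\<^esub> (2 * k)"
  proof -
    have "mat \<epsilon> ** (mat \<epsilon> ** P) = P" for P :: rat_mat2
      using r(2) by (auto simp: mat2_eq_iff scalar_mult_nth)
    then show ?thesis by (simp only: signed_power_def mult_2)
  qed
  finally have "laxton_class t (X \<otimes>\<^bsub>nonsingular_R t\<^esub> X) = \<one>\<^bsub>laxton_group t\<^esub>"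
    using laxton_class_eq_one_iff[OF N.m_closed[OF X X]] by auto
  then show ?thesis using h.hom_mult[OF X X] by simp
qed

text \<open>The four ratios exhaust the combinations of sign and parity. They come from \<open>C = D - D\<^sup>-\<^sup>1\<close>, \<open>W = 1 + D\<^sup>-\<^sup>1\<close> and
  \<open>V = 1 - D\<^sup>-\<^sup>1\<close>: conjugation exchanges \<open>D\<close> and \<open>D\<^sup>-\<^sup>1\<close>, so it negates \<open>C\<close> and multiplies \<open>W\<close> by \<open>D\<close>
  and \<open>V\<close> by \<open>-D\<close>.\<close>

lemma conj_ratio_representatives:
  assumes t2: "t ^ 2 \<noteq> 4"
  shows "mat 1 \<in> carrier (nonsingular_R t)" "elt t 2 t \<in> carrier (nonsingular_R t)"
      "elt t (-1) 1 \<in> carrier (nonsingular_R t)" "elt t 1 1 \<in> carrier (nonsingular_R t)"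
    and "conj_ratio (mat 1) = signed_power t 1 0" "conj_ratio (elt t 2 t) = signed_power t (-1) 0"
      "conj_ratio (elt t (-1) 1) = signed_power t 1 (-1)"
      "conj_ratio (elt t 1 1) = signed_power t (-1) (-1)"
proof -
  interpret N: comm_group "nonsingular_R t" by (rule comm_group_nonsingular_R)
  interpret q: group_hom "nonsingular_R t" "nonsingular_R t" conj_ratio
    by (rule conj_ratio_hom)
  note D = D_mat_in_nonsingular_R[of t]
  have "(t + 2) * (t - 2) \<noteq> 0"
    using t2 by (simp add: power2_eq_square algebra_simps)
  then have t_ne: "t + 2 \<noteq> 0" "2 - t \<noteq> 0" "4 - t ^ 2 \<noteq> 0" using t2 by auto
  have D_inv: "D_mat t [^]\<^bsub>nonsingular_R t\<^esub> (-1::int) = elt t (-1) 0"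
  proof -
    have "inv\<^bsub>nonsingular_R t\<^esub> D_mat t = elt t (-1) 0"
      using D by (intro N.inv_equality)
        (auto simp: D_mat_eq_elt elt_mult one_eq_elt[of t] elt_in_nonsingular_R_iff det_elt
          power2_eq_square)
    then show ?thesis using D by (simp add: N.int_pow_neg)
  qed
  have dets: "det (elt t 2 t) = 4 - t ^ 2" "det (elt t (-1) 1) = t + 2" "det (elt t 1 1) = 2 - t"
    by (simp_all add: det_elt power2_eq_square algebra_simps)
  show "mat 1 \<in> carrier (nonsingular_R t)" "elt t 2 t \<in> carrier (nonsingular_R t)"
      "elt t (-1) 1 \<in> carrier (nonsingular_R t)" "elt t 1 1 \<in> carrier (nonsingular_R t)"
    using t_ne by (simp_all only: elt_in_nonsingular_R_iff dets scalar_in_nonsingular_R)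
      (simp_all add: scalar_in_nonsingular_R)
  show "conj_ratio (mat 1) = signed_power t 1 0"
    using q.hom_one by (simp add: signed_power_def)
  show "conj_ratio (elt t 2 t) = signed_power t (-1) 0"
    using t_ne(3) by (simp add: signed_power_def conj_ratio_elt dets mat2_eq_iff elt_nth mat2_nth field_simps)
  show "conj_ratio (elt t (-1) 1) = signed_power t 1 (-1)"
    using t_ne(1)
    by (simp add: signed_power_def D_inv conj_ratio_elt dets mat2_eq_iff elt_nth field_simps)
  show "conj_ratio (elt t 1 1) = signed_power t (-1) (-1)"
    using t_ne(2)
    by (simp add: signed_power_def D_inv conj_ratio_elt dets scalar_mult_elt mat2_eq_iff elt_nth field_simps)
qed

theorem proposition20:
  fixes t :: rat
  assumes "t \<noteq> 0" "t \<noteq> 1" "t \<noteq> -1" "t \<noteq> 2" "t \<noteq> -2"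
    and "primitive t"
    and "twin_primitive t"
    and "\<not> cyclotomic t"
  shows "carrier (torsion_subgroup (laxton_group t)) =
           {laxton_class t (mat 1), laxton_class t (elt t 2 t),
            laxton_class t (elt t (-1) 1), laxton_class t (elt t 1 1)}
       \<and> distinct [laxton_class t (mat 1), laxton_class t (elt t 2 t),
            laxton_class t (elt t (-1) 1), laxton_class t (elt t 1 1)]
       \<and> torsion_subgroup (laxton_group t) \<cong> integer_mod_group 2 \<times>\<times> integer_mod_group 2"
proof -
  interpret A: comm_group "laxton_group t" by (rule comm_group_laxton_group)
  interpret h: group_hom "nonsingular_R t" "laxton_group t" "laxton_class t"
    by (rule laxton_class_hom)
  interpret q: group_hom "nonsingular_R t" "nonsingular_R t" conj_ratio
    by (rule conj_ratio_hom)
  note cyc = assms(8)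
  note class_eq_iff = laxton_class_eq_iff_sign_parity[OF cyc]
  note reps = conj_ratio_representatives(1-4)[OF not_cyclotomic_imp_square_neq_4[OF cyc]]
  note ratio = conj_ratio_representatives(5-8)[OF not_cyclotomic_imp_square_neq_4[OF cyc]]

  let ?Cl = "{laxton_class t (mat 1), laxton_class t (elt t 2 t),
              laxton_class t (elt t (-1) 1), laxton_class t (elt t 1 1)}"
  have dist: "distinct [laxton_class t (mat 1), laxton_class t (elt t 2 t),
            laxton_class t (elt t (-1) 1), laxton_class t (elt t 1 1)]"
    by (simp add: class_eq_iff[OF reps(1,2) ratio(1,2)] class_eq_iff[OF reps(1,3) ratio(1,3)]
        class_eq_iff[OF reps(1,4) ratio(1,4)] class_eq_iff[OF reps(2,3) ratio(2,3)]
        class_eq_iff[OF reps(2,4) ratio(2,4)] class_eq_iff[OF reps(3,4) ratio(3,4)])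
  have one: "laxton_class t (mat 1) = \<one>\<^bsub>laxton_group t\<^esub>"
    using h.hom_one by simp

  \<comment> \<open>The ratio of a torsion element is \<open>\<plusminus>D\<^sup>k\<close>, and one of the four representatives has the same sign and the
    same parity of exponent.\<close>
  have torsion_sub: "x \<in> ?Cl" if x: "x \<in> torsion_set (laxton_group t)" for x
  proof -
    obtain X and n :: nat where X: "X \<in> carrier (nonsingular_R t)" "x = laxton_class t X"
      and n: "n > 0" "x [^]\<^bsub>laxton_group t\<^esub> n = \<one>\<^bsub>laxton_group t\<^esub>"
      using x by (auto simp: torsion_set_def laxton_class_surj)
    have "laxton_class t (X [^]\<^bsub>nonsingular_R t\<^esub> n) = \<one>\<^bsub>laxton_group t\<^esub>"
      using n X by (simp add: h.hom_nat_pow)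
    then obtain M :: int where "conj_ratio (X [^]\<^bsub>nonsingular_R t\<^esub> n) = D_mat t [^]\<^bsub>nonsingular_R t\<^esub> (2 * M)"
      using laxton_class_eq_one_iff X(1) by blast
    then have "conj_ratio X [^]\<^bsub>nonsingular_R t\<^esub> n = D_mat t [^]\<^bsub>nonsingular_R t\<^esub> (2 * M)"
      using X by (simp add: q.hom_nat_pow)
    moreover have "det (conj_ratio X) = 1"
      using X(1) by (intro det_conj_ratio) (simp add: nonsingular_R_def)
    moreover have "conj_ratio X \<in> carrier (nonsingular_R t)" by (rule q.hom_closed[OF X(1)])
    moreover have "r_primitive 2 (- t)" using assms(7) by (simp add: twin_primitive_def)
    ultimately obtain \<epsilon> k where \<epsilon>: "\<epsilon> \<in> {1, -1}" "conj_ratio X = signed_power t \<epsilon> k"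
      using primitive_norm_one_root[OF assms(6) _ cyc] n(1) by blast
    note eq = class_eq_iff[OF X(1) _ \<epsilon>(2) _ \<epsilon>(1)]
    show ?thesis
      using \<epsilon>(1) unfolding X(2)
      using eq[OF reps(1) ratio(1)] eq[OF reps(2) ratio(2)] eq[OF reps(3) ratio(3)] eq[OF reps(4) ratio(4)]
      by (cases "even k") auto
  qed
  have invol: "x \<otimes>\<^bsub>laxton_group t\<^esub> x = \<one>\<^bsub>laxton_group t\<^esub>" if "x \<in> ?Cl" for x
    using that laxton_class_square_eq_one[OF reps(1) ratio(1)]
      laxton_class_square_eq_one[OF reps(2) ratio(2)] laxton_class_square_eq_one[OF reps(3) ratio(3)]
      laxton_class_square_eq_one[OF reps(4) ratio(4)]
    by (elim insertE emptyE) (simp_all only: insert_iff simp_thms)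
  have cl_carrier: "?Cl \<subseteq> carrier (laxton_group t)"
    using reps h.hom_closed by blast
  have torsion: "torsion_set (laxton_group t) = ?Cl"
  proof
    show "?Cl \<subseteq> torsion_set (laxton_group t)"
    proof
      fix x assume x: "x \<in> ?Cl"
      then have car: "x \<in> carrier (laxton_group t)" by (rule subsetD[OF cl_carrier])
      then have "x [^]\<^bsub>laxton_group t\<^esub> (2::nat) = \<one>\<^bsub>laxton_group t\<^esub>"
        using invol[OF x] by (simp add: numeral_2_eq_2)
      with car show "x \<in> torsion_set (laxton_group t)"
        unfolding torsion_set_def by (intro CollectI conjI exI[of _ 2]) simp_all
    qed
    show "torsion_set (laxton_group t) \<subseteq> ?Cl" by (rule subsetI) (rule torsion_sub)
  qed
  have carrier_eq: "carrier (torsion_subgroup (laxton_group t)) = ?Cl"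
    by (rule trans[OF _ torsion]) (simp add: torsion_subgroup_def)
  interpret T: group "torsion_subgroup (laxton_group t)"
    unfolding torsion_subgroup_def
    by (rule A.subgroup_imp_group[OF subgroup_torsion_set[OF comm_group_laxton_group]])
  have one_eq: "\<one>\<^bsub>torsion_subgroup (laxton_group t)\<^esub> = \<one>\<^bsub>laxton_group t\<^esub>"
    by (simp add: torsion_subgroup_def)
  have "torsion_subgroup (laxton_group t) \<cong> integer_mod_group 2 \<times>\<times> integer_mod_group 2"
  proof (rule T.klein_four_group)
    show "carrier (torsion_subgroup (laxton_group t)) =
        {\<one>\<^bsub>torsion_subgroup (laxton_group t)\<^esub>, laxton_class t (elt t 2 t),
         laxton_class t (elt t (-1) 1), laxton_class t (elt t 1 1)}"
      by (simp add: carrier_eq one one_eq)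
    show "distinct [\<one>\<^bsub>torsion_subgroup (laxton_group t)\<^esub>, laxton_class t (elt t 2 t),
         laxton_class t (elt t (-1) 1), laxton_class t (elt t 1 1)]"
      using dist by (simp only: one one_eq)
  next
    fix x assume "x \<in> carrier (torsion_subgroup (laxton_group t))"
    then have "x \<in> ?Cl" by (simp only: carrier_eq)
    from invol[OF this] show "x \<otimes>\<^bsub>torsion_subgroup (laxton_group t)\<^esub> x = \<one>\<^bsub>torsion_subgroup (laxton_group t)\<^esub>"
      by (simp add: torsion_subgroup_def)
  qed
  with carrier_eq dist show ?thesis by blast
qed

end
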